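(* Let $M$ be a uniform matroid on a ground set $E=\{e_1,\ldots,e_n\}$ and, for $i\in\{0,\ldots,n\}$, let $E_i=\{e_1,\ldots,e_i\}$. Then the number of minors of $M$ on $E\setminus E_i$ is $\lambda_M(E_i)+1$.
   Context: A matroid $M$ is uniform if its independent sets are exactly the subsets of $E$ of size at most $r(M)$. $r_M(X)=\max\{|I|: I\subseteq X, I \text{ independent}\}$ is the rank function, $r(M)=r_M(E)$, and the connectivity function is $\lambda_M(X)=r_M(X)+r_M(E\setminus X)-r(M)$. For disjoint $X,Y\subseteq E$, $M\setminus X/Y$ denotes the matroid obtained by deleting $X$ and contracting $Y$. The minors of $M$ on $E\setminus E_i$ are the matroids $M\setminus(E_i\setminus Y)/Y$ for $Y\subseteq E_i$; their number means the number of distinct such matroids (distinct collections of independent sets). *)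

theory Defs
  imports Main
begin

record 'a set_system =
  ground :: "'a set"
  indeps :: "'a set set"

definition matroid :: "'a set_system \<Rightarrow> bool" where
  "matroid M \<longleftrightarrow>
     finite (ground M) \<and>
     indeps M \<subseteq> Pow (ground M) \<and>
     {} \<in> indeps M \<and>
     (\<forall>I\<in>indeps M. \<forall>J\<subseteq>I. J \<in> indeps M) \<and>
     (\<forall>I\<in>indeps M. \<forall>J\<in>indeps M. card I < card J \<longrightarrow> (\<exists>x\<in>J - I. insert x I \<in> indeps M))"

definition rank_of :: "'a set_system \<Rightarrow> 'a set \<Rightarrow> nat" where
  "rank_of M X = Max (card ` {I \<in> indeps M. I \<subseteq> X})"

definition matroid_rank :: "'a set_system \<Rightarrow> nat" where
  "matroid_rank M = rank_of M (ground M)"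

text \<open>Integer-valued, so that the subtraction is not truncated.\<close>
definition connectivity :: "'a set_system \<Rightarrow> 'a set \<Rightarrow> int" where
  "connectivity M X =
     int (rank_of M X) + int (rank_of M (ground M - X)) - int (matroid_rank M)"

definition uniform :: "'a set_system \<Rightarrow> bool" where
  "uniform M \<longleftrightarrow> indeps M = {I. I \<subseteq> ground M \<and> card I \<le> matroid_rank M}"

definition bases :: "'a set_system \<Rightarrow> 'a set set" where
  "bases M = {B \<in> indeps M. \<forall>I\<in>indeps M. B \<subseteq> I \<longrightarrow> I = B}"

definition dual :: "'a set_system \<Rightarrow> 'a set_system" where
  "dual M = \<lparr>ground = ground M, indeps = {I. \<exists>B\<in>bases M. I \<subseteq> ground M - B}\<rparr>"

definition delete :: "'a set_system \<Rightarrow> 'a set \<Rightarrow> 'a set_system" where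
  "delete M X = \<lparr>ground = ground M - X, indeps = {I \<in> indeps M. I \<inter> X = {}}\<rparr>"

definition contract :: "'a set_system \<Rightarrow> 'a set \<Rightarrow> 'a set_system" where
  "contract M Y = dual (delete (dual M) Y)"

text \<open>The minors of \<open>M\<close> on \<open>ground M - F\<close>. They all have the same ground set, so two of them
  are equal exactly when they have the same independent sets.\<close>
definition minors_off :: "'a set_system \<Rightarrow> 'a set \<Rightarrow> 'a set_system set" where
  "minors_off M F = {contract (delete M (F - Y)) Y | Y. Y \<subseteq> F}"

end

theory Submission
  imports Defs
begin

text \<open>Write \<open>r\<close> for the rank of \<open>M\<close>, \<open>m\<close> for the size of \<open>E\<^sub>i\<close>, and \<open>c = n - m\<close>.
  Deletion and contraction preserve uniformity, and the minor of \<open>M\<close> obtained by contracting a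
  \<open>k\<close>-subset of \<open>E\<^sub>i\<close> and deleting the rest of it is the uniform matroid on the remaining \<open>c\<close>
  elements of rank \<open>min (r - k) c\<close> (with truncated subtraction). As \<open>k\<close> runs through
  \<open>0, \<dots>, m\<close> this rank takes exactly the values between \<open>r - m\<close> and \<open>min r c\<close>, and since
  \<open>r - (r - m) = min r m\<close> is the rank of \<open>E\<^sub>i\<close>, the number of these values is the connectivity
  plus one.\<close>

text \<open>\<open>r\<close> is only a cap on sizes; it is the rank exactly when \<open>r\<close>
  \<le> \<open>card E\<close>, for finite \<open>E\<close>.\<close>

definition unif :: "'a set \<Rightarrow> nat \<Rightarrow> 'a set_system" where
  "unif E r = \<lparr>ground = E, indeps = {I. I \<subseteq> E \<and> card I \<le> r}\<rparr>"

lemma ground_unif [simp]: "ground (unif E r) = E"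
  and indeps_unif [simp]: "indeps (unif E r) = {I. I \<subseteq> E \<and> card I \<le> r}"
  by (simp_all add: unif_def)

lemma obtain_superset_with_card:
  assumes "finite E" "I \<subseteq> E" "card I \<le> k" "k \<le> card E"
  obtains B where "I \<subseteq> B" "B \<subseteq> E" "card B = k"
  using assms exists_subset_between by metis

lemma rank_of_unif:
  assumes "finite E" "X \<subseteq> E"
  shows "rank_of (unif E r) X = min r (card X)"
  unfolding rank_of_def
proof (rule Max_eqI)
  have fin: "finite X"
    using assms finite_subset by blast
  have "{I \<in> indeps (unif E r). I \<subseteq> X} \<subseteq> Pow X"
    by blast
  with fin show "finite (card ` {I \<in> indeps (unif E r). I \<subseteq> X})"
    by (meson finite_Pow_iff finite_imageI finite_subset)
  show "y \<le> min r (card X)" if "y \<in> card ` {I \<in> indeps (unif E r). I \<subseteq> X}" for y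
    using that fin by (auto intro: card_mono)
  obtain T where "T \<subseteq> X" "card T = min r (card X)"
    using obtain_subset_with_card_n[of "min r (card X)" X] by auto
  with assms show "min r (card X) \<in> card ` {I \<in> indeps (unif E r). I \<subseteq> X}"
    by (intro image_eqI[of _ _ T]) auto
qed

text \<open>The rank of the whole ground set recovers the parameter; this is what lets distinct
  ranks count as distinct minors.\<close>

lemma unif_eq_iff:
  assumes "finite E" "r \<le> card E" "s \<le> card E"
  shows "unif E r = unif E s \<longleftrightarrow> r = s"
proof
  assume "unif E r = unif E s"
  then have "rank_of (unif E r) E = rank_of (unif E s) E"
    by simp
  with assms show "r = s"
    by (simp add: rank_of_unif)
qed simp

lemma bases_unif:
  assumes "finite E" "r \<le> card E"
  shows "bases (unif E r) = {B. B \<subseteq> E \<and> card B = r}"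
proof (intro equalityI subsetI)
  fix B assume "B \<in> bases (unif E r)"
  then have B: "B \<subseteq> E" "card B \<le> r"
    and max: "\<And>I. I \<subseteq> E \<Longrightarrow> card I \<le> r \<Longrightarrow> B \<subseteq> I \<Longrightarrow> I = B"
    by (auto simp: bases_def)
  \<comment> \<open>Maximality will force \<open>C = B\<close>, so \<open>B\<close> has size exactly
    \<open>r\<close>.\<close>
  obtain C where "B \<subseteq> C" "C \<subseteq> E" "card C = r"
    using obtain_superset_with_card assms B by metis
  with max[of C] show "B \<in> {B. B \<subseteq> E \<and> card B = r}"
    by simp
next
  fix B assume "B \<in> {B. B \<subseteq> E \<and> card B = r}"
  then have B: "B \<subseteq> E" "card B = r"
    by auto
  have "I = B" if "I \<subseteq> E" "card I \<le> r" "B \<subseteq> I" for I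
    using card_seteq[of I B] that B(2) finite_subset[OF that(1) assms(1)] by simp
  with B show "B \<in> bases (unif E r)"
    by (simp add: bases_def)
qed

text \<open>A set misses some \<open>r\<close>-subset of \<open>E\<close> iff it extends to the
  complement of one, a set of size \<open>card E - r\<close>.\<close>

lemma dual_unif:
  assumes "finite E" "r \<le> card E"
  shows "dual (unif E r) = unif E (card E - r)"
proof -
  have "(\<exists>B. B \<subseteq> E \<and> card B = r \<and> I \<subseteq> E - B) \<longleftrightarrow> I \<subseteq> E \<and> card I \<le> card E - r" for I
  proof
    assume "\<exists>B. B \<subseteq> E \<and> card B = r \<and> I \<subseteq> E - B"
    then obtain B where B: "B \<subseteq> E" "card B = r" "I \<subseteq> E - B"
      by blast
    then have "card I \<le> card (E - B)"
      using assms by (simp add: card_mono)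
    with B assms show "I \<subseteq> E \<and> card I \<le> card E - r"
      by (auto simp: card_Diff_subset finite_subset)
  next
    assume "I \<subseteq> E \<and> card I \<le> card E - r"
    then obtain C where C: "I \<subseteq> C" "C \<subseteq> E" "card C = card E - r"
      using obtain_superset_with_card[of E I "card E - r"] assms by auto
    then have "card (E - C) = r"
      using assms by (simp add: card_Diff_subset finite_subset)
    with C show "\<exists>B. B \<subseteq> E \<and> card B = r \<and> I \<subseteq> E - B"
      by (intro exI[of _ "E - C"]) auto
  qed
  then show ?thesis
    using assms
    by (simp add: dual_def bases_unif Bex_def conj_assoc unif_def[of E "card E - r"])
qed

text \<open>The cap is cut down to the true rank, as dualizing and contracting require.\<close>

lemma delete_unif:
  assumes "finite E"
  shows "delete (unif E r) X = unif (E - X) (min r (card (E - X)))"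
  using assms by (auto simp: delete_def unif_def intro: card_mono)

text \<open>Dualize, delete, dualize: the rank goes from \<open>r\<close> to
  \<open>card E - r\<close>, is capped at \<open>card E - card Y\<close>, and is subtracted from
  that size. If \<open>card Y\<close> exceeds \<open>r\<close>, the cap is attained and the result
  is 0.\<close>

lemma contract_unif:
  assumes "finite E" "r \<le> card E" "Y \<subseteq> E"
  shows "contract (unif E r) Y = unif (E - Y) (r - card Y)"
proof -
  have Y: "card Y \<le> card E" "card (E - Y) = card E - card Y"
    using assms by (auto simp: card_mono card_Diff_subset finite_subset)
  then have "card E - card Y - min (card E - r) (card E - card Y) = r - card Y"
    using assms(2) by linarith
  with assms Y show ?thesis
    by (simp add: contract_def dual_unif delete_unif)
qed

lemma minor_unif:
  assumes "finite E" "F \<subseteq> E" "Y \<subseteq> F"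
  shows "contract (delete (unif E r) (F - Y)) Y
    = unif (E - F) (min (r - card Y) (card (E - F)))"
proof -
  have fin: "finite (E - F)" "finite Y"
    using assms by (auto dest: finite_subset)
  have split: "E - (F - Y) = (E - F) \<union> Y" "(E - F) \<inter> Y = {}" "(E - F) \<union> Y - Y = E - F"
    using assms by auto
  have card: "card ((E - F) \<union> Y) = card (E - F) + card Y"
    using fin split(2) by (rule card_Un_disjoint)
  have "contract (delete (unif E r) (F - Y)) Y
    = unif (E - F) (min r (card (E - F) + card Y) - card Y)"
    using fin assms(1) by (simp add: delete_unif split contract_unif card)
  also have "min r (card (E - F) + card Y) - card Y = min (r - card Y) (card (E - F))"
    by linarith
  finally show ?thesis .
qed

lemma card_image_Pow:
  assumes "finite F"
  shows "card ` Pow F = {..card F}"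
proof (intro equalityI subsetI)
  fix k assume "k \<in> {..card F}"
  then obtain T where "T \<subseteq> F" "card T = k"
    using obtain_subset_with_card_n[of k F] by auto
  then show "k \<in> card ` Pow F"
    by blast
qed (use assms in \<open>auto intro: card_mono\<close>)

text \<open>The hypothesis keeps the cap \<open>c\<close> from falling below
  \<open>r - m\<close>.\<close>

lemma image_min_diff:
  fixes r c m :: nat
  assumes "r \<le> c + m"
  shows "(\<lambda>k. min (r - k) c) ` {..m} = {r - m..min r c}"
proof (intro equalityI subsetI)
  fix v assume "v \<in> {r - m..min r c}"
  \<comment> \<open>The value \<open>v\<close> is attained at \<open>k = r - v\<close>.\<close>
  then have "v = min (r - (r - v)) c" "r - v \<in> {..m}"
    by auto
  then show "v \<in> (\<lambda>k. min (r - k) c) ` {..m}"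
    by (rule image_eqI)
qed (use assms in auto)

lemma minors_off_unif:
  assumes "finite E" "F \<subseteq> E" "r \<le> card E"
  shows "minors_off (unif E r) F = unif (E - F) ` {r - card F..min r (card (E - F))}"
proof -
  have fin: "finite F"
    using assms finite_subset by blast
  have le: "r \<le> card (E - F) + card F"
    using assms fin by (simp add: card_Diff_subset)
  have "minors_off (unif E r) F = (\<lambda>Y. contract (delete (unif E r) (F - Y)) Y) ` Pow F"
    by (auto simp: minors_off_def)
  also have "\<dots> = (\<lambda>Y. unif (E - F) (min (r - card Y) (card (E - F)))) ` Pow F"
    using assms by (intro image_cong) (auto simp: minor_unif)
  \<comment> \<open>The minor depends on \<open>Y\<close> only through its size.\<close>
  also have "\<dots> = unif (E - F) ` (\<lambda>k. min (r - k) (card (E - F))) ` card ` Pow F"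
    by (simp add: image_image)
  finally show ?thesis
    using fin le by (simp add: card_image_Pow image_min_diff)
qed

lemma card_minors_off_unif:
  assumes "finite E" "F \<subseteq> E" "r \<le> card E"
  shows "int (card (minors_off (unif E r) F)) = connectivity (unif E r) F + 1"
proof -
  have "inj_on (unif (E - F)) {r - card F..min r (card (E - F))}"
    using assms by (auto simp: inj_on_def unif_eq_iff)
  then have "card (minors_off (unif E r) F) = Suc (min r (card (E - F))) - (r - card F)"
    using assms by (simp add: minors_off_unif card_image)
  \<comment> \<open>This makes the interval of ranks nonempty, so the natural subtraction in its
    size is exact.\<close>
  moreover have "r \<le> card (E - F) + card F"
    using assms by (simp add: card_Diff_subset finite_subset)
  ultimately show ?thesis
    using assms by (simp add: connectivity_def matroid_rank_def rank_of_unif)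
qed

lemma uniform_matroid_eq_unif:
  assumes "uniform M"
  shows "M = unif (ground M) (matroid_rank M)"
  using assms by (simp add: uniform_def unif_def)

text \<open>The rank is its own cap: computing it by \<open>rank_of_unif\<close> shows that it
  equals its minimum with \<open>card (ground M)\<close>.\<close>

lemma matroid_rank_le_card_ground:
  assumes "matroid M" "uniform M"
  shows "matroid_rank M \<le> card (ground M)"
proof -
  have "rank_of (unif (ground M) (matroid_rank M)) (ground M)
    = min (matroid_rank M) (card (ground M))"
    using assms(1) by (intro rank_of_unif) (auto simp: matroid_def)
  then show ?thesis
    unfolding uniform_matroid_eq_unif[OF assms(2), symmetric]
    by (simp add: matroid_rank_def)
qed

theorem theorem4p1:
  fixes M :: "'a set_system" and e :: "nat \<Rightarrow> 'a" and n i :: nat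
  assumes "matroid M"
    and "uniform M"
    and "inj_on e {1..n}"
    and "ground M = e ` {1..n}"
    and "i \<le> n"
  shows "int (card (minors_off M (e ` {1..i}))) = connectivity M (e ` {1..i}) + 1"
proof -
  have "e ` {1..i} \<subseteq> ground M"
    using assms(4,5) by auto
  moreover have "finite (ground M)"
    using assms(1) by (simp add: matroid_def)
  ultimately show ?thesis
    using card_minors_off_unif[of "ground M" "e ` {1..i}" "matroid_rank M"]
      matroid_rank_le_card_ground[OF assms(1,2)]
    unfolding uniform_matroid_eq_unif[OF assms(2), symmetric] by blast
qed

end
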